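(* For all integers $r\ge 1$ and $n\ge 1$, $$S_{r,1,n}= (-1)^r \sum_{\{r\}} \prod_{j=1}^l \frac{(-1)^{i_j}}{i_j!}\left( \frac{H_n^{(r_j)}}{r_j} \right)^{i_j},$$ where the sum runs over all partitions $\{r\}=r_1^{i_1}\cdots r_l^{i_l}$ of the integer $r$, i.e. $r=i_1r_1+\dots+i_lr_l$ with pairwise distinct parts $r_1,\dots,r_l\ge 1$ and multiplicities $i_1,\dots,i_l\ge 1$ ($l$ depends on the partition).
   Context: $H_n^{(s)}:=\sum_{k=1}^n k^{-s}$. $S_{r,s,t}:=\sum_{s\le i_1<\dots<i_r\le t}\frac{1}{i_1\cdots i_r}$ (sum over integers), so $S_{r,1,n}$ is the $r$-th elementary symmetric function of $1,\frac12,\dots,\frac1n$; it equals $\left[{n+1\atop r+1}\right]/n!$ with $\left[{n\atop k}\right]$ the (unsigned) Stirling numbers of the first kind. *)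

theory Defs
  imports Complex_Main "HOL-Library.Multiset"
begin

definition gen_harm :: "nat \<Rightarrow> nat \<Rightarrow> real" where
  "gen_harm s n = (\<Sum>k = 1..n. 1 / real k ^ s)"

definition increasing_tuples :: "nat \<Rightarrow> nat \<Rightarrow> nat \<Rightarrow> nat list set" where
  "increasing_tuples r s t = {xs. length xs = r \<and> sorted_wrt (<) xs \<and> set xs \<subseteq> {s..t}}"

definition mult_harm_sum :: "nat \<Rightarrow> nat \<Rightarrow> nat \<Rightarrow> real" where
  "mult_harm_sum r s t = (\<Sum>xs \<in> increasing_tuples r s t. \<Prod>i\<leftarrow>xs. 1 / real i)"

(* A partition of r is the multiset of its parts: the distinct parts r_1, ..., r_l are
   the elements of set_mset p, and the multiplicity of the part k is count p k. *)
definition int_partitions :: "nat \<Rightarrow> nat multiset set" where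
  "int_partitions r = {p. 0 \<notin># p \<and> \<Sum>\<^sub># p = r}"

(* Both index sets are finite, so the sums over them are not the default value 0. *)

lemma finite_increasing_tuples: "finite (increasing_tuples r s t)"
proof (rule finite_subset)
  show "increasing_tuples r s t \<subseteq> {xs. set xs \<subseteq> {s..t} \<and> length xs = r}"
    by (auto simp: increasing_tuples_def)
qed (simp add: finite_lists_length_eq)

lemma finite_int_partitions: "finite (int_partitions r)"
proof (rule finite_subset)
  show "int_partitions r \<subseteq> mset ` {xs. set xs \<subseteq> {..r} \<and> length xs \<le> r}"
  proof
    fix p assume "p \<in> int_partitions r"
    then have p: "0 \<notin># p" "\<Sum>\<^sub># p = r"
      by (auto simp: int_partitions_def)
    have "size q \<le> \<Sum>\<^sub># q" if "0 \<notin># q" for q :: "nat multiset"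
      using that by (induction q) auto
    then have "size p \<le> r" using p by blast
    moreover have "set_mset p \<subseteq> {..r}"
      using p(2) by (auto dest: multi_member_split)
    moreover obtain xs where "p = mset xs"
      using ex_mset by metis
    ultimately show "p \<in> mset ` {xs. set xs \<subseteq> {..r} \<and> length xs \<le> r}"
      by auto
  qed
qed (simp add: finite_lists_length_le)

end

theory Submission
  imports Defs "HOL-Computational_Algebra.Formal_Power_Series"
begin

text \<open>
  Both sides satisfy the same recurrence in \<open>r\<close>, namely Newton's identity relating the
  elementary symmetric functions \<open>e\<^sub>r\<close> and the power sums \<open>p\<^sub>k\<close> of \<open>1, 1/2, \<dots>, 1/n\<close>,
  \<open>r e\<^sub>r = \<Sum>k=1..r. (-1)^(k-1) p\<^sub>k e\<^sub>r\<^sub>-\<^sub>k\<close>. It determines both sides from their common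
  value \<open>1\<close> at \<open>r = 0\<close>.

  For the multiple harmonic sums (\<open>mult_harm_sum_newton\<close>), it is the logarithmic derivative
  of the generating function \<open>\<Prod>i=1..n. 1 + X / i\<close>, whose coefficients they are.

  For the partition sum (\<open>partition_sum_recurrence\<close>), write \<open>x\<^sub>k = - p\<^sub>k / k\<close>, so that a partition
  in which the part \<open>k\<close> occurs \<open>c\<^sub>k\<close> times has weight \<open>\<Prod>k. x\<^sub>k ^ c\<^sub>k / c\<^sub>k!\<close>. Multiply this weight by
  \<open>r = \<Sum>k. k c\<^sub>k\<close>: the factor \<open>c\<^sub>k\<close> turns \<open>x\<^sub>k ^ c\<^sub>k / c\<^sub>k!\<close> into \<open>x\<^sub>k\<close> times the corresponding factor for the
  partition of \<open>r - k\<close> obtained by removing one part \<open>k\<close>. Summing over all partitions and all their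
  distinct parts gives the recurrence. The sign \<open>(-1)^r\<close> of the theorem converts
  \<open>k x\<^sub>k = - p\<^sub>k\<close> into the alternating signs of Newton's identity.
\<close>

definition multiset_weight :: "(nat \<Rightarrow> real) \<Rightarrow> nat multiset \<Rightarrow> real" where
  "multiset_weight x p = (\<Prod>k \<in> set_mset p. x k ^ count p k / fact (count p k))"

text \<open>Over a larger index set the weights of different multisets can be compared factor by factor.\<close>

lemma multiset_weight_superset:
  assumes "finite A" "set_mset p \<subseteq> A"
  shows "multiset_weight x p = (\<Prod>k \<in> A. x k ^ count p k / fact (count p k))"
  unfolding multiset_weight_def
  using assms by (intro prod.mono_neutral_left) (auto simp: not_in_iff)

lemma count_times_multiset_weight_add_mset:
  "real (count (add_mset k q) k) * multiset_weight x (add_mset k q) = x k * multiset_weight x q"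
proof -
  let ?A = "insert k (set_mset q)"
  let ?g = "\<lambda>p j. x j ^ count p j / fact (count p j)"
  have split: "multiset_weight x p = ?g p k * prod (?g p) (?A - {k})" if "set_mset p \<subseteq> ?A" for p
    using multiset_weight_superset[of ?A p x] prod.remove[of ?A k "?g p"] that by simp
  have rest: "prod (?g (add_mset k q)) (?A - {k}) = prod (?g q) (?A - {k})"
    by (intro prod.cong) auto
  have "real (Suc c) * (x k ^ Suc c / fact (Suc c)) = x k * (x k ^ c / fact c)" for c
    by (simp add: divide_simps)
  then have head: "real (count (add_mset k q) k) * ?g (add_mset k q) k = x k * ?g q k"
    by (simp only: count_add_mset simp_thms if_True)
  have "real (count (add_mset k q) k) * multiset_weight x (add_mset k q) =
      real (count (add_mset k q) k) * ?g (add_mset k q) k * prod (?g q) (?A - {k})"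
    using split[of "add_mset k q"] rest by (simp only: set_mset_add_mset_insert order.refl mult.assoc)
  also have "\<dots> = x k * multiset_weight x q"
    using split[of q] by (simp only: head subset_insertI mult.assoc)
  finally show ?thesis .
qed

lemma sum_mset_conv_count:
  "\<Sum>\<^sub># p = (\<Sum>k \<in> set_mset p. count p k * (k :: nat))"
proof -
  obtain xs where "p = mset xs"
    using ex_mset by metis
  then show ?thesis
    using sum_list_map_eq_sum_count[of id xs] by (simp add: sum_mset_sum_list count_mset)
qed

text \<open>
  Pairs of a partition of \<open>r\<close> and one of its distinct parts \<open>k\<close> correspond bijectively to pairs of a
  number \<open>1 \<le> k \<le> r\<close> and a partition of \<open>r - k\<close>, by removing one copy of \<open>k\<close>. In generating functions,
  this is the differential equation of \<open>exp (\<Sum>k. x\<^sub>k t^k)\<close>.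
\<close>

lemma partition_sum_recurrence:
  "real r * (\<Sum>p \<in> int_partitions r. multiset_weight x p) =
    (\<Sum>k = 1..r. real k * x k * (\<Sum>q \<in> int_partitions (r - k). multiset_weight x q))"
proof -
  let ?w = "multiset_weight x"
  have "real r * (\<Sum>p \<in> int_partitions r. ?w p) =
      (\<Sum>p \<in> int_partitions r. \<Sum>k \<in> set_mset p. real k * (real (count p k) * ?w p))"
    unfolding sum_distrib_left
  proof (intro sum.cong refl)
    fix p assume "p \<in> int_partitions r"
    then have "r = (\<Sum>k \<in> set_mset p. count p k * k)"
      by (simp add: int_partitions_def sum_mset_conv_count)
    then have "real r = (\<Sum>k \<in> set_mset p. real (count p k) * real k)"
      by (metis (mono_tags, lifting) of_nat_mult of_nat_sum sum.cong)
    then show "real r * ?w p = (\<Sum>k \<in> set_mset p. real k * (real (count p k) * ?w p))"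
      by (simp add: sum_distrib_right sum_distrib_left mult_ac)
  qed
  also have "\<dots> = (\<Sum>(p, k) \<in> (SIGMA p:int_partitions r. set_mset p).
      real k * (real (count p k) * ?w p))"
    by (simp add: sum.Sigma finite_int_partitions)
  also have "\<dots> = (\<Sum>(k, q) \<in> (SIGMA k:{1..r}. int_partitions (r - k)). real k * x k * ?w q)"
  proof (rule sum.reindex_bij_witness[where
        i = "\<lambda>(k, q). (add_mset k q, k)" and j = "\<lambda>(p, k). (k, p - {#k#})"])
    fix a assume "a \<in> (SIGMA p:int_partitions r. set_mset p)"
    then obtain k q where a: "a = (add_mset k q, k)" and q: "add_mset k q \<in> int_partitions r"
      by (auto dest!: multi_member_split)
    show "(case case a of (p, k) \<Rightarrow> (k, p - {#k#}) of (k, q) \<Rightarrow> (add_mset k q, k)) = a"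
      by (simp add: a)
    show "(case a of (p, k) \<Rightarrow> (k, p - {#k#})) \<in> (SIGMA k:{1..r}. int_partitions (r - k))"
      using q by (auto simp: a int_partitions_def)
    show "(case case a of (p, k) \<Rightarrow> (k, p - {#k#}) of (k, q) \<Rightarrow> real k * x k * ?w q) =
        (case a of (p, k) \<Rightarrow> real k * (real (count p k) * ?w p))"
      using count_times_multiset_weight_add_mset[of k q x] by (simp add: a)
  qed (auto simp: int_partitions_def)
  also have "\<dots> = (\<Sum>k = 1..r. real k * x k * (\<Sum>q \<in> int_partitions (r - k). ?w q))"
    by (simp add: sum.Sigma[symmetric] finite_int_partitions sum_distrib_left)
  finally show ?thesis .
qed

lemma increasing_tuples_0: "increasing_tuples 0 s t = {[]}"
  by (auto simp: increasing_tuples_def)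

lemma mult_harm_sum_0: "mult_harm_sum 0 s t = 1"
  by (simp add: mult_harm_sum_def increasing_tuples_0)

text \<open>A tuple bounded by \<open>n + 1\<close> either stays below \<open>n + 1\<close> or has \<open>n + 1\<close> as its last entry.\<close>

lemma increasing_tuples_Suc_Suc:
  "increasing_tuples (Suc r) 1 (Suc n) =
    increasing_tuples (Suc r) 1 n \<union> (\<lambda>xs. xs @ [Suc n]) ` increasing_tuples r 1 n"
proof (intro equalityI subsetI)
  fix xs assume xs: "xs \<in> increasing_tuples (Suc r) 1 (Suc n)"
  then obtain ys y where y: "xs = ys @ [y]"
    by (cases xs rule: rev_cases) (auto simp: increasing_tuples_def)
  have ys: "length ys = r" "sorted_wrt (<) ys" "\<forall>z \<in> set ys. 1 \<le> z \<and> z < y" "1 \<le> y" "y \<le> Suc n"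
    using xs by (auto simp: increasing_tuples_def y sorted_wrt_append)
  show "xs \<in> increasing_tuples (Suc r) 1 n \<union> (\<lambda>xs. xs @ [Suc n]) ` increasing_tuples r 1 n"
  proof (cases "y = Suc n")
    case True
    with ys show ?thesis
      by (intro UnI2) (fastforce simp: y increasing_tuples_def)
  next
    case False
    with ys show ?thesis
      by (fastforce simp: y increasing_tuples_def sorted_wrt_append)
  qed
qed (fastforce simp: increasing_tuples_def sorted_wrt_append)+

lemma mult_harm_sum_Suc_Suc:
  "mult_harm_sum (Suc r) 1 (Suc n) =
    mult_harm_sum (Suc r) 1 n + mult_harm_sum r 1 n / real (Suc n)"
proof -
  have disj: "increasing_tuples (Suc r) 1 n \<inter> (\<lambda>xs. xs @ [Suc n]) ` increasing_tuples r 1 n = {}"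
    by (auto simp: increasing_tuples_def)
  have "(\<Sum>xs \<in> (\<lambda>xs. xs @ [Suc n]) ` increasing_tuples r 1 n. \<Prod>i\<leftarrow>xs. 1 / real i) =
      mult_harm_sum r 1 n / real (Suc n)"
    by (simp add: sum.reindex inj_on_def mult_harm_sum_def sum_divide_distrib)
  then show ?thesis
    unfolding mult_harm_sum_def increasing_tuples_Suc_Suc
    by (simp add: sum.union_disjoint disj[simplified] finite_increasing_tuples)
qed

text \<open>
  The left factor is \<open>\<Prod>i=1..n. 1 + X / i\<close>. The right one is its logarithmic derivative
  \<open>\<Sum>i=1..n. (1/i) / (1 + X / i)\<close>, expanded into geometric series. Induction on \<open>n\<close> proves the
  equation one factor at a time, without dividing by power series.
\<close>

lemma mult_harm_sum_fps_deriv: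
  "fps_deriv (Abs_fps (\<lambda>r. mult_harm_sum r 1 n)) =
    Abs_fps (\<lambda>r. mult_harm_sum r 1 n) * Abs_fps (\<lambda>k. (-1) ^ k * gen_harm (Suc k) n)"
proof (induction n)
  case 0
  have "increasing_tuples (Suc r) 1 0 = {}" for r
    by (auto simp: increasing_tuples_def length_Suc_conv)
  then show ?case
    by (intro fps_ext) (simp add: mult_harm_sum_def gen_harm_def fps_mult_nth)
next
  case (Suc n)
  define a where "a = 1 / real (Suc n)"
  define E where "E m = Abs_fps (\<lambda>r. mult_harm_sum r 1 m)" for m
  define P where "P m = Abs_fps (\<lambda>k. (-1) ^ k * gen_harm (Suc k) m)" for m
  define G where "G = Abs_fps (\<lambda>k. (-1) ^ k * a ^ Suc k)"
  let ?L = "1 + fps_const a * fps_X"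
  have E: "E (Suc n) = E n * ?L"
  proof (rule fps_ext)
    fix r show "fps_nth (E (Suc n)) r = fps_nth (E n * ?L) r"
      by (cases r) (simp_all add: E_def a_def mult_harm_sum_0 mult_harm_sum_Suc_Suc[simplified]
          distrib_left mult.assoc[symmetric])
  qed
  have P: "P (Suc n) = P n + G"
    by (rule fps_ext) (simp add: P_def G_def a_def gen_harm_def power_one_over algebra_simps)
  \<comment> \<open>\<open>G\<close> is the geometric series of \<open>a / (1 + a X)\<close>, the logarithmic derivative of the new factor.\<close>
  have G: "?L * G = fps_const a"
  proof (rule fps_ext)
    fix k show "fps_nth (?L * G) k = fps_nth (fps_const a) k"
      by (cases k) (simp_all add: G_def distrib_right mult.assoc)
  qed
  have "fps_deriv (E (Suc n)) = fps_deriv (E n) * ?L + E n * fps_const a"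
    by (simp add: E)
  also have "\<dots> = E n * ?L * P n + E n * (?L * G)"
    using Suc by (simp only: G) (simp only: E_def P_def mult_ac)
  also have "\<dots> = E (Suc n) * P (Suc n)"
    unfolding E P distrib_left[of "E n * ?L"] by (simp only: mult.assoc)
  finally show ?case
    by (simp only: E_def P_def)
qed

lemma mult_harm_sum_newton:
  "real r * mult_harm_sum r 1 n =
    (\<Sum>k = 1..r. (-1) ^ (k - 1) * gen_harm k n * mult_harm_sum (r - k) 1 n)"
proof (cases r)
  case (Suc m)
  have "real r * mult_harm_sum r 1 n =
      (\<Sum>i = 0..m. mult_harm_sum (m - i) 1 n * ((-1) ^ i * gen_harm (Suc i) n))"
    using arg_cong[OF mult_harm_sum_fps_deriv[of n], of "\<lambda>f. fps_nth f m"] Suc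
    by (subst sum.atLeastAtMost_rev) (simp add: fps_mult_nth)
  then show ?thesis
    by (simp add: Suc sum.shift_bounds_cl_Suc_ivl mult_ac del: sum.cl_ivl_Suc)
qed simp

theorem mainTheorem1:
  fixes r n :: nat
  assumes "r \<ge> 1" and "n \<ge> 1"
  shows "mult_harm_sum r 1 n =
    (-1) ^ r * (\<Sum>p \<in> int_partitions r. \<Prod>k \<in> set_mset p.
      (-1) ^ count p k / fact (count p k) * (gen_harm k n / real k) ^ count p k)"
proof -
  define x where "x k = - (gen_harm k n / real k)" for k
  define Z where "Z r = (\<Sum>p \<in> int_partitions r. multiset_weight x p)" for r
  have "mult_harm_sum r 1 n = (-1) ^ r * Z r"
  proof (induction r rule: less_induct)
    case (less r)
    show ?case
    proof (cases "r = 0")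
      case True
      have "int_partitions 0 = {{#}}"
        by (auto simp: int_partitions_def) (metis multiset_nonemptyE)
      with True show ?thesis
        by (simp add: Z_def multiset_weight_def mult_harm_sum_0)
    next
      case False
      have "real r * mult_harm_sum r 1 n =
          (\<Sum>k = 1..r. (-1) ^ (k - 1) * gen_harm k n * ((-1) ^ (r - k) * Z (r - k)))"
        unfolding mult_harm_sum_newton using less by (intro sum.cong) auto
      also have "\<dots> = (\<Sum>k = 1..r. (-1) ^ r * (real k * x k * Z (r - k)))"
      proof (intro sum.cong refl)
        fix k assume k: "k \<in> {1..r}"
        then have "r = Suc (k - 1 + (r - k))"
          by simp
        then have "(-1::real) ^ r = - ((-1) ^ (k - 1) * (-1) ^ (r - k))"
          by (metis power_Suc power_add mult_minus1)
        with k show "(-1) ^ (k - 1) * gen_harm k n * ((-1) ^ (r - k) * Z (r - k)) =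
            (-1) ^ r * (real k * x k * Z (r - k))"
          by (simp add: x_def)
      qed
      also have "\<dots> = real r * ((-1) ^ r * Z r)"
        by (simp only: Z_def sum_distrib_left[symmetric] partition_sum_recurrence[symmetric]
            mult.left_commute)
      finally show ?thesis
        using False by simp
    qed
  qed
  also have "Z r = (\<Sum>p \<in> int_partitions r. \<Prod>k \<in> set_mset p.
      (-1) ^ count p k / fact (count p k) * (gen_harm k n / real k) ^ count p k)"
    unfolding Z_def multiset_weight_def x_def
    by (intro sum.cong prod.cong refl) (simp add: power_minus[of "gen_harm _ n / real _"])
  finally show ?thesis .
qed

end
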